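(* Let $D$ be an integral domain that is not a field. Then $D$ is a VFD with $t$-$\dim(D)=1$ if and only if $D$ is a weakly factorial GCD-domain.
   Context: Let $D$ be an integral domain with quotient field $K$. An overring of $D$ is a subring of $K$ containing $D$. A nonzero nonunit $a\in D$ is a valuation element of $D$ if there is a valuation domain $V$ that is an overring of $D$ with $aV\cap D=aD$. $D$ is a VFD (valuation factorization domain) if every nonzero nonunit of $D$ is a finite product of valuation elements. A nonzero nonunit $x\in D$ is primary if $xD$ is a primary ideal. $D$ is a weakly factorial domain if every nonzero nonunit is a finite product of primary elements; a weakly factorial GCD-domain is a GCD-domain that is weakly factorial. For a nonzero fractional ideal $A$ let $A^{-1}=\{x\in K\mid xA\subseteq D\}$, $A_v=(A^{-1})^{-1}$ and $A_t=\bigcup\{I_v\mid I\subseteq A,\ I$ a nonzero finitely generated fractional ideal$\}$. $A$ is a $t$-ideal if $A_t=A$; a prime $t$-ideal is a (nonzero) prime ideal that is a $t$-ideal. $t$-$\dim(D)=\sup\{n\mid P_1\subsetneq\cdots\subsetneq P_n$ for some prime $t$-ideals $P_i$ of $D\}$. *)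

theory Defs
  imports
    "HOL-Computational_Algebra.Polynomial_Factorial"
    "HOL-Library.Extended_Nat"
begin

text \<open>
  An integral domain \<open>D\<close> is a type of class \<open>idom\<close>, and its quotient field \<open>K\<close> is the type
  \<open>'a fract\<close>, into which \<open>D\<close> embeds by \<open>to_fract\<close>.  Integral ideals are sets over \<open>'a\<close>;
  overrings and fractional ideals are sets over \<open>'a fract\<close>.
\<close>

section \<open>Integral ideals\<close>

definition is_ideal :: "'a::comm_ring_1 set \<Rightarrow> bool" where
  "is_ideal I \<longleftrightarrow> 0 \<in> I \<and> (\<forall>a\<in>I. \<forall>b\<in>I. a + b \<in> I) \<and> (\<forall>r. \<forall>a\<in>I. r * a \<in> I)"

definition principal_ideal :: "'a::comm_ring_1 \<Rightarrow> 'a set" where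
  "principal_ideal a = range (\<lambda>r. a * r)"

definition is_prime_ideal :: "'a::comm_ring_1 set \<Rightarrow> bool" where
  "is_prime_ideal P \<longleftrightarrow>
     is_ideal P \<and> P \<noteq> UNIV \<and> (\<forall>a b. a * b \<in> P \<longrightarrow> a \<in> P \<or> b \<in> P)"

definition is_primary_ideal :: "'a::comm_ring_1 set \<Rightarrow> bool" where
  "is_primary_ideal Q \<longleftrightarrow>
     is_ideal Q \<and> Q \<noteq> UNIV \<and> (\<forall>a b. a * b \<in> Q \<longrightarrow> a \<in> Q \<or> (\<exists>n>0. b ^ n \<in> Q))"


section \<open>Overrings and valuation domains\<close>

definition is_subring :: "'k::field set \<Rightarrow> bool" where
  "is_subring V \<longleftrightarrow>
     0 \<in> V \<and> 1 \<in> V \<and> (\<forall>x\<in>V. \<forall>y\<in>V. x - y \<in> V) \<and> (\<forall>x\<in>V. \<forall>y\<in>V. x * y \<in> V)"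

definition is_overring :: "'a::idom fract set \<Rightarrow> bool" where
  "is_overring V \<longleftrightarrow> is_subring V \<and> range to_fract \<subseteq> V"

definition quotient_field_in :: "'k::field set \<Rightarrow> 'k set" where
  "quotient_field_in V = {x / y | x y. x \<in> V \<and> y \<in> V \<and> y \<noteq> 0}"

text \<open>Fields count as (trivial) valuation domains.\<close>

definition is_valuation_domain :: "'k::field set \<Rightarrow> bool" where
  "is_valuation_domain V \<longleftrightarrow>
     is_subring V \<and> (\<forall>x\<in>quotient_field_in V. x \<noteq> 0 \<longrightarrow> x \<in> V \<or> inverse x \<in> V)"


section \<open>Factorization properties\<close>

text \<open>\<open>a dvd 1\<close> says that \<open>a\<close> is a unit.\<close>

definition valuation_element :: "'a::idom \<Rightarrow> bool" where
  "valuation_element a \<longleftrightarrow> a \<noteq> 0 \<and> \<not> a dvd 1 \<and>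
     (\<exists>V. is_overring V \<and> is_valuation_domain V \<and>
          (\<lambda>v. to_fract a * v) ` V \<inter> range to_fract = to_fract ` principal_ideal a)"

definition primary_element :: "'a::idom \<Rightarrow> bool" where
  "primary_element a \<longleftrightarrow> a \<noteq> 0 \<and> \<not> a dvd 1 \<and> is_primary_ideal (principal_ideal a)"

definition VFD :: "'a::idom itself \<Rightarrow> bool" where
  "VFD _ \<longleftrightarrow> (\<forall>a::'a. a \<noteq> 0 \<and> \<not> a dvd 1 \<longrightarrow>
     (\<exists>xs. (\<forall>x\<in>set xs. valuation_element x) \<and> a = prod_list xs))"

definition weakly_factorial :: "'a::idom itself \<Rightarrow> bool" where
  "weakly_factorial _ \<longleftrightarrow> (\<forall>a::'a. a \<noteq> 0 \<and> \<not> a dvd 1 \<longrightarrow>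
     (\<exists>xs. (\<forall>x\<in>set xs. primary_element x) \<and> a = prod_list xs))"

text \<open>
  Mere existence of greatest common divisors; the class \<open>semiring_gcd\<close> would in addition
  fix a choice of them.
\<close>

definition GCD_domain :: "'a::idom itself \<Rightarrow> bool" where
  "GCD_domain _ \<longleftrightarrow> (\<forall>a b::'a. \<exists>d. d dvd a \<and> d dvd b \<and> (\<forall>c. c dvd a \<and> c dvd b \<longrightarrow> c dvd d))"

definition weakly_factorial_GCD_domain :: "'a::idom itself \<Rightarrow> bool" where
  "weakly_factorial_GCD_domain D \<longleftrightarrow> GCD_domain D \<and> weakly_factorial D"


section \<open>Fractional ideals and the t-operation\<close>

definition fract_scale :: "'a::idom \<Rightarrow> 'a fract \<Rightarrow> 'a fract" where
  "fract_scale r x = to_fract r * x"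

text \<open>
  \<open>K\<close> as a \<open>D\<close>-module: \<open>fract_mod.subspace\<close> are the \<open>D\<close>-submodules of \<open>K\<close>, and
  \<open>fract_mod.span F\<close> is the \<open>D\<close>-submodule generated by \<open>F\<close>.
\<close>

global_interpretation fract_mod: module "fract_scale :: 'a::idom \<Rightarrow> 'a fract \<Rightarrow> 'a fract"
  by unfold_locales (simp_all add: fract_scale_def algebra_simps)

definition is_fractional_ideal :: "'a::idom fract set \<Rightarrow> bool" where
  "is_fractional_ideal A \<longleftrightarrow>
     fract_mod.subspace A \<and> (\<exists>d::'a. d \<noteq> 0 \<and> (\<forall>x\<in>A. to_fract d * x \<in> range to_fract))"

definition is_fg_fractional_ideal :: "'a::idom fract set \<Rightarrow> bool" where
  "is_fg_fractional_ideal A \<longleftrightarrow>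
     is_fractional_ideal A \<and> (\<exists>F. finite F \<and> A = fract_mod.span F)"

definition inverse_ideal :: "'a::idom fract set \<Rightarrow> 'a fract set" where
  "inverse_ideal A = {x. \<forall>a\<in>A. x * a \<in> range to_fract}"

definition v_closure :: "'a::idom fract set \<Rightarrow> 'a fract set" where
  "v_closure A = inverse_ideal (inverse_ideal A)"

definition t_closure :: "'a::idom fract set \<Rightarrow> 'a fract set" where
  "t_closure A = \<Union> {v_closure I | I. I \<subseteq> A \<and> I \<noteq> {0} \<and> is_fg_fractional_ideal I}"

definition is_t_ideal :: "'a::idom fract set \<Rightarrow> bool" where
  "is_t_ideal A \<longleftrightarrow> is_fractional_ideal A \<and> A \<noteq> {0} \<and> t_closure A = A"

definition is_prime_t_ideal :: "'a::idom set \<Rightarrow> bool" where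
  "is_prime_t_ideal P \<longleftrightarrow> is_prime_ideal P \<and> P \<noteq> {0} \<and> is_t_ideal (to_fract ` P)"

text \<open>
  A chain \<open>P 1 \<subset> \<dots> \<subset> P n\<close> counts its \<open>n\<close> nonzero primes, so the zero ideal is not
  included in the count; without prime t-ideals the value is \<open>0\<close>.
\<close>

definition t_dim :: "'a::idom itself \<Rightarrow> enat" where
  "t_dim _ = Sup {enat n | n. \<exists>P :: nat \<Rightarrow> 'a set.
     (\<forall>i\<in>{1..n}. is_prime_t_ideal (P i)) \<and> (\<forall>i\<in>{1..<n}. P i \<subset> P (Suc i))}"

end

theory Submission
  imports Defs
begin

text \<open>
  Everything is organised around the radical \<open>radical a\<close> of a principal ideal \<open>a D\<close>.

  Let \<open>D\<close> be a VFD of t-dimension one.  For a valuation element \<open>a\<close> with valuation overring \<open>V\<close>,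
  the equation \<open>a V \<inter> D = a D\<close> lets divisibility by \<open>a\<close> be tested in \<open>V\<close>, and it is inherited by all
  powers and divisors of \<open>a\<close>.  Since divisibility in \<open>V\<close> is total, \<open>radical a\<close> is a prime t-ideal
  (\<open>radical_valuation_element_t_prime\<close>), and a valuation element \<open>b \<in> radical a\<close>
  is comparable with \<open>a\<close>, both being divisors of a power of \<open>b\<close>; the product \<open>a b\<close>
  is again a valuation element (\<open>valuation_element_class\<close>).  In t-dimension one, distinct radicals
  of valuation elements are incomparable, so valuation elements fall into classes according to their radical,
  and every nonzero \<open>z\<close> has a factorization \<open>z\<^sub>0 z'\<close>, where \<open>z\<^sub>0\<close> belongs to the class of \<open>a\<close> or is
  \<open>1\<close>, and \<open>z' \<notin> radical a\<close> (\<open>split_off_class\<close>).  Comparing such splittings of the two sides of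
  \<open>a c = s x\<close> with \<open>s \<notin> radical a\<close> shows that \<open>a\<close> divides \<open>x\<close> (\<open>valuation_element_cancel\<close>).  This is
  exactly primariness of \<open>a\<close>.  It also yields greatest common divisors one class at a time:
  the smaller of \<open>a\<close> and \<open>z\<^sub>0\<close> is the greatest common divisor of \<open>a\<close> and \<open>z\<close>, and the cofactors that
  remain are coprime in a sense strong enough to pass to products of valuation elements
  (\<open>VFD_t_dim_1_gcd_splitting\<close>).

  Conversely, let \<open>D\<close> be a weakly factorial GCD-domain and \<open>q\<close> primary.  Powers of coprime elements are
  coprime, so \<open>radical q\<close> cannot contain two coprime elements.  Consequently the
  localization of \<open>D\<close> at \<open>radical q\<close> is a valuation domain, which makes \<open>q\<close> a valuation element
  (\<open>primary_element_valuation\<close>), and \<open>radical q\<close> is closed under greatest common divisors, which makes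
  it a prime t-ideal (\<open>radical_primary_t_prime\<close>).  On the other hand every prime t-ideal is closed
  under greatest common divisors, so two primary elements in the same prime t-ideal
  have a nonunit greatest common divisor and hence the same radical (\<open>primary_in_t_prime\<close>).  As prime
  ideals are determined by their primary elements here, no prime t-ideal lies properly above another;
  and one exists, since a nonzero nonunit has a primary factor \<open>q\<close>.
\<close>


section \<open>Prime ideals and radicals of principal ideals\<close>

definition radical :: "'a::comm_ring_1 \<Rightarrow> 'a set" where
  "radical a = {z. \<exists>n. a dvd z ^ n}"

lemma radicalI: "a dvd z ^ n \<Longrightarrow> z \<in> radical a"
  by (auto simp: radical_def)

lemma self_in_radical: "a \<in> radical a"
  by (rule radicalI[where n = 1]) simp

lemma radical_mult:
  assumes "z \<in> radical a" shows "r * z \<in> radical a"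
proof -
  from assms obtain n where "a dvd z ^ n" by (auto simp: radical_def)
  hence "a dvd (r * z) ^ n" by (simp add: power_mult_distrib)
  thus ?thesis by (rule radicalI)
qed

lemma radical_subset:
  assumes "b \<in> radical a" shows "radical b \<subseteq> radical a"
proof
  fix z assume "z \<in> radical b"
  then obtain m where "b dvd z ^ m" by (auto simp: radical_def)
  then obtain c where c: "z ^ m = b * c" by (auto simp: dvd_def)
  from assms obtain n where "a dvd b ^ n" by (auto simp: radical_def)
  hence "a dvd (z ^ m) ^ n" unfolding c by (simp add: power_mult_distrib)
  thus "z \<in> radical a" by (intro radicalI[of _ _ "m * n"]) (simp add: power_mult)
qed

lemma radical_nonunit:
  assumes "\<not> a dvd 1" "z \<in> radical a" shows "\<not> z dvd 1"
proof
  assume "z dvd 1"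
  then obtain w where w: "z * w = 1" by (metis dvdE)
  from assms(2) have "w * z \<in> radical a" by (rule radical_mult)
  hence "1 \<in> radical a" using w by (simp add: mult.commute)
  thus False using assms(1) by (simp add: radical_def)
qed

lemma is_prime_ideal_radicalI:
  fixes a :: "'a::idom"
  assumes "\<not> a dvd 1"
    and "\<And>z w. z \<in> radical a \<Longrightarrow> w \<in> radical a \<Longrightarrow> z + w \<in> radical a"
    and "\<And>z w. z * w \<in> radical a \<Longrightarrow> z \<in> radical a \<or> w \<in> radical a"
  shows "is_prime_ideal (radical a)"
proof -
  have "0 \<in> radical a" using radicalI[of a 0 1] by simp
  moreover have "radical a \<noteq> UNIV" using radical_nonunit[OF assms(1), of 1] by auto
  ultimately show ?thesis
    unfolding is_prime_ideal_def is_ideal_def using assms(2,3) radical_mult by blast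
qed

lemma prime_ideal_prod_list:
  assumes "is_prime_ideal P" "prod_list xs \<in> P" shows "\<exists>x\<in>set xs. x \<in> P"
  using assms(2)
proof (induction xs)
  case Nil
  hence "x \<in> P" for x
    using assms(1) unfolding is_prime_ideal_def is_ideal_def
    by (metis mult.right_neutral prod_list.Nil)
  with assms(1) show ?case by (auto simp: is_prime_ideal_def)
next
  case (Cons x xs)
  thus ?case using assms(1) by (auto simp: is_prime_ideal_def)
qed


section \<open>Divisibility in a valuation overring\<close>

definition valuation_overring :: "'a::idom fract set \<Rightarrow> bool" where
  "valuation_overring V \<longleftrightarrow> is_overring V \<and> is_valuation_domain V"

definition divides_in :: "'a::idom fract set \<Rightarrow> 'a \<Rightarrow> 'a \<Rightarrow> bool" where
  "divides_in V x y \<longleftrightarrow> (\<exists>v\<in>V. to_fract y = to_fract x * v)"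

text \<open>The equation \<open>a V \<inter> D = a D\<close> in terms of divisibility.\<close>

definition contracted :: "'a::idom fract set \<Rightarrow> 'a \<Rightarrow> bool" where
  "contracted V a \<longleftrightarrow> (\<forall>z. divides_in V a z \<longrightarrow> a dvd z)"

lemma fract_cases:
  fixes x :: "'a::idom fract"
  obtains p q where "x = to_fract p / to_fract q" "q \<noteq> 0"
  by (cases x) (auto simp: Fract_conv_to_fract)

lemma to_fract_power [simp]: "to_fract (x ^ n) = to_fract x ^ n"
  by (induction n) auto

lemma valuation_element_iff:
  "valuation_element a \<longleftrightarrow>
     a \<noteq> 0 \<and> \<not> a dvd 1 \<and> (\<exists>V. valuation_overring V \<and> contracted V a)"
proof -
  have "(\<lambda>v. to_fract a * v) ` V \<inter> range to_fract = to_fract ` principal_ideal a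
          \<longleftrightarrow> contracted V a" if "is_overring V" for V
  proof -
    have "to_fract r \<in> V" for r using that by (auto simp: is_overring_def)
    hence "to_fract ` principal_ideal a \<subseteq> (\<lambda>v. to_fract a * v) ` V \<inter> range to_fract"
      by (auto simp: principal_ideal_def)
    moreover have "(\<lambda>v. to_fract a * v) ` V \<inter> range to_fract \<subseteq> to_fract ` principal_ideal a
        \<longleftrightarrow> contracted V a" (is "?L \<longleftrightarrow> ?R")
    proof
      assume L: ?L
      show ?R unfolding contracted_def
      proof (intro allI impI)
        fix z assume "divides_in V a z"
        hence "to_fract z \<in> (\<lambda>v. to_fract a * v) ` V \<inter> range to_fract"
          by (auto simp: divides_in_def)
        hence "to_fract z \<in> to_fract ` principal_ideal a" using L by blast
        hence "z \<in> principal_ideal a" by auto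
        thus "a dvd z" by (auto simp: principal_ideal_def)
      qed
    next
      assume R: ?R
      show ?L
      proof (rule subsetI, elim IntE imageE)
        fix x v z assume "x = to_fract a * v" "v \<in> V" "x = to_fract z"
        hence "divides_in V a z" by (auto simp: divides_in_def)
        hence "a dvd z" using R by (auto simp: contracted_def)
        thus "x \<in> to_fract ` principal_ideal a" using \<open>x = to_fract z\<close>
          by (auto simp: principal_ideal_def elim!: dvdE)
      qed
    qed
    ultimately show ?thesis by blast
  qed
  thus ?thesis unfolding valuation_element_def valuation_overring_def by blast
qed

context
  fixes V :: "'a::idom fract set"
  assumes V: "valuation_overring V"
begin

lemma valuation_overring_closed:
  "to_fract r \<in> V" "x \<in> V \<Longrightarrow> y \<in> V \<Longrightarrow> x * y \<in> V" "x \<in> V \<Longrightarrow> y \<in> V \<Longrightarrow> x + y \<in> V"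
proof -
  have sub: "is_subring V" and *: "to_fract r \<in> V" for r
    using V by (auto simp: valuation_overring_def is_overring_def)
  thus "to_fract r \<in> V" "x \<in> V \<Longrightarrow> y \<in> V \<Longrightarrow> x * y \<in> V" by (auto simp: is_subring_def)
  assume xy: "x \<in> V" "y \<in> V"
  have "x - (0 - y) \<in> V" using sub xy unfolding is_subring_def by blast
  thus "x + y \<in> V" by simp
qed

lemma divides_in_total: "divides_in V x y \<or> divides_in V y x"
proof (cases "x = 0 \<or> y = 0")
  case True
  have "0 \<in> V" using valuation_overring_closed(1)[of 0] by simp
  with True show ?thesis by (force simp: divides_in_def)
next
  case False
  let ?q = "to_fract y / to_fract x"
  have "?q \<in> quotient_field_in V"
    using False valuation_overring_closed(1) unfolding quotient_field_in_def by force
  hence "?q \<in> V \<or> inverse ?q \<in> V"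
    using V False by (auto simp: valuation_overring_def is_valuation_domain_def)
  moreover have "to_fract y = to_fract x * ?q" "to_fract x = to_fract y * inverse ?q"
    using False by auto
  ultimately show ?thesis unfolding divides_in_def by blast
qed

lemma dvd_imp_divides_in: "x dvd y \<Longrightarrow> divides_in V x y"
  using valuation_overring_closed(1) by (auto simp: divides_in_def elim!: dvdE)

lemma divides_in_trans:
  assumes "divides_in V x y" "divides_in V y z" shows "divides_in V x z"
proof -
  from assms obtain v w where "v \<in> V" "w \<in> V" "to_fract y = to_fract x * v"
    "to_fract z = to_fract y * w" by (auto simp: divides_in_def)
  thus ?thesis unfolding divides_in_def
    by (intro bexI[of _ "v * w"]) (auto simp: valuation_overring_closed)
qed

lemma divides_in_mult:
  assumes "divides_in V x y" "divides_in V x' y'" shows "divides_in V (x * x') (y * y')"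
proof -
  from assms obtain v w where "v \<in> V" "w \<in> V" "to_fract y = to_fract x * v"
    "to_fract y' = to_fract x' * w" by (auto simp: divides_in_def)
  thus ?thesis unfolding divides_in_def
    by (intro bexI[of _ "v * w"]) (auto simp: valuation_overring_closed)
qed

lemma divides_in_power: "divides_in V x y \<Longrightarrow> divides_in V (x ^ n) (y ^ n)"
  by (induction n) (auto intro: divides_in_mult dvd_imp_divides_in)

lemma divides_in_add:
  assumes "divides_in V x y" "divides_in V x z" shows "divides_in V x (y + z)"
proof -
  from assms obtain v w where "v \<in> V" "w \<in> V" "to_fract y = to_fract x * v"
    "to_fract z = to_fract x * w" by (auto simp: divides_in_def)
  thus ?thesis unfolding divides_in_def
    by (intro bexI[of _ "v + w"]) (auto simp: valuation_overring_closed algebra_simps)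
qed

lemma divides_in_mult_cancel: "c \<noteq> 0 \<Longrightarrow> divides_in V (c * x) (c * y) \<Longrightarrow> divides_in V x y"
  by (auto simp: divides_in_def mult.assoc)

text \<open>Multiplying a multiple of \<open>b\<close> in \<open>V\<close> by the cofactor of \<open>b\<close> in \<open>a\<close> gives a multiple of \<open>a\<close>.\<close>

lemma contracted_dvd:
  assumes "contracted V a" "a \<noteq> 0" "b dvd a" shows "contracted V b"
  unfolding contracted_def
proof (intro allI impI)
  fix z assume "divides_in V b z"
  from \<open>b dvd a\<close> obtain c where c: "a = c * b" by (metis dvdE mult.commute)
  have "divides_in V a (c * z)"
    unfolding c by (intro divides_in_mult dvd_imp_divides_in \<open>divides_in V b z\<close> dvd_refl)
  with assms(1) have "c * b dvd c * z" by (auto simp: contracted_def c)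
  thus "b dvd z" using assms(2) c by auto
qed

lemma contracted_mult:
  assumes "contracted V a" "contracted V b" "a \<noteq> 0" shows "contracted V (a * b)"
  unfolding contracted_def
proof (intro allI impI)
  fix z assume z: "divides_in V (a * b) z"
  have "divides_in V a (a * b)" by (rule dvd_imp_divides_in) simp
  hence "a dvd z" using divides_in_trans z assms(1) by (auto simp: contracted_def)
  then obtain w where w: "z = a * w" by (auto simp: dvd_def)
  hence "divides_in V b w" using z divides_in_mult_cancel assms(3) by simp
  hence "b dvd w" using assms(2) by (auto simp: contracted_def)
  thus "a * b dvd z" by (simp add: w)
qed

lemma contracted_power:
  assumes "contracted V a" "a \<noteq> 0" shows "contracted V (a ^ n)"
proof (induction n)
  case 0
  show ?case by (simp add: contracted_def)
next
  case (Suc n)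
  thus ?case using contracted_mult[OF assms(1) Suc assms(2)] by simp
qed

text \<open>
  Two divisors of \<open>a\<close> are comparable in \<open>V\<close>.  Both are contracted themselves, so the divisibility
  in \<open>V\<close> descends to \<open>D\<close>.
\<close>

lemma divisors_of_contracted_comparable:
  assumes "contracted V a" "a \<noteq> 0" "x dvd a" "y dvd a"
  shows "x dvd y \<or> y dvd x"
  using divides_in_total[of x y] contracted_dvd[OF assms(1,2,3)] contracted_dvd[OF assms(1,2,4)]
  unfolding contracted_def by blast

text \<open>
  \<open>radical a\<close> is the contraction of the radical of \<open>a V\<close>, and every proper radical ideal of a
  valuation domain is prime: of two elements one divides the other, so it also divides their sum,
  and their product divides the square of the other.
\<close>

lemma radical_contracted_prime:
  assumes "contracted V a" "\<not> a dvd 1"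
  shows "is_prime_ideal (radical a)"
proof (rule is_prime_ideal_radicalI[OF assms(2)])
  \<comment> \<open>Membership in the radical may be tested in \<open>V\<close> and on powers.\<close>
  have down: "w \<in> radical a" if "divides_in V (z ^ k) (w ^ k)" "z ^ k \<in> radical a" for z w k
  proof -
    from that(2) obtain n where "a dvd (z ^ k) ^ n" by (auto simp: radical_def)
    hence "divides_in V a ((w ^ k) ^ n)"
      by (rule divides_in_trans[OF dvd_imp_divides_in divides_in_power[OF that(1)]])
    hence "a dvd (w ^ k) ^ n" using assms(1) by (auto simp: contracted_def)
    thus ?thesis by (intro radicalI[of _ _ "k * n"]) (simp add: power_mult)
  qed
  fix z w
  show "z + w \<in> radical a" if "z \<in> radical a" "w \<in> radical a"
  proof -
    have "divides_in V z (z + w) \<or> divides_in V w (z + w)"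
      using divides_in_total[of z w] divides_in_add[of z z w] divides_in_add[of w z w]
        dvd_imp_divides_in[of z z] dvd_imp_divides_in[of w w] by auto
    thus ?thesis using down[of z 1] down[of w 1] that by auto
  qed
  show "z \<in> radical a \<or> w \<in> radical a" if "z * w \<in> radical a"
  proof -
    have aux: "y \<in> radical a" if "divides_in V x y" "x * y \<in> radical a" for x y
    proof -
      have "divides_in V (x * y) (y * y)"
        by (intro divides_in_mult that dvd_imp_divides_in dvd_refl)
      hence "y * y \<in> radical a" using down[of "x * y" 1 "y * y"] that by auto
      thus ?thesis using down[of y 2 y] dvd_imp_divides_in by (auto simp: power2_eq_square)
    qed
    show ?thesis
      using divides_in_total[of z w] aux[of z w] aux[of w z] that by (auto simp: mult.commute)
  qed
qed

lemma divides_in_all_of_finite: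
  assumes "finite F" "F \<noteq> {}"
  shows "\<exists>f\<in>F. \<forall>g\<in>F. divides_in V f g"
  using assms
proof (induction rule: finite_ne_induct)
  case (singleton x)
  thus ?case using dvd_imp_divides_in by auto
next
  case (insert x F)
  then obtain f where "f \<in> F" "\<forall>g\<in>F. divides_in V f g" by blast
  moreover have "divides_in V x x" by (simp add: dvd_imp_divides_in)
  moreover have "divides_in V x g" if "divides_in V x f" "g \<in> F" for g
    using divides_in_trans[OF that(1)] calculation(2) that(2) by blast
  ultimately show ?case using divides_in_total[of f x] by blast
qed

end


section \<open>Integral t-ideals\<close>

lemma subspace_to_fract_image:
  assumes "is_ideal P" shows "fract_mod.subspace (to_fract ` P)"
proof (rule fract_mod.subspaceI)
  show "0 \<in> to_fract ` P" using assms by (auto simp: is_ideal_def image_iff intro!: bexI[of _ 0])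
next
  fix x y assume "x \<in> to_fract ` P" "y \<in> to_fract ` P"
  then obtain p q where "p \<in> P" "q \<in> P" "x = to_fract p" "y = to_fract q" by blast
  thus "x + y \<in> to_fract ` P"
    using assms by (auto simp: is_ideal_def simp flip: to_fract_add)
next
  fix c x assume "x \<in> to_fract ` P"
  then obtain p where "p \<in> P" "x = to_fract p" by blast
  thus "fract_scale c x \<in> to_fract ` P"
    using assms by (auto simp: is_ideal_def fract_scale_def simp flip: to_fract_mult)
qed

lemma fractional_ideal_integral:
  assumes "fract_mod.subspace A" "A \<subseteq> range to_fract" shows "is_fractional_ideal A"
  unfolding is_fractional_ideal_def using assms by (auto intro!: exI[of _ 1])

lemma fg_fractional_ideal_span:
  assumes "is_ideal P" "finite F" "F \<subseteq> P"
  shows "is_fg_fractional_ideal (fract_mod.span (to_fract ` F))"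
    and "fract_mod.span (to_fract ` F) \<subseteq> to_fract ` P"
proof -
  show *: "fract_mod.span (to_fract ` F) \<subseteq> to_fract ` P"
    using assms by (intro fract_mod.span_minimal subspace_to_fract_image) auto
  have "is_fractional_ideal (fract_mod.span (to_fract ` F))"
    using * by (intro fractional_ideal_integral) auto
  thus "is_fg_fractional_ideal (fract_mod.span (to_fract ` F))"
    unfolding is_fg_fractional_ideal_def using assms(2) by blast
qed

lemma subset_v_closure: "I \<subseteq> v_closure I"
  by (auto simp: v_closure_def inverse_ideal_def mult.commute)

text \<open>
  Finitely generated fractional ideals inside an integral ideal have generators in \<open>D\<close>, so
  closedness only has to be tested on finite subsets of \<open>P\<close>.
\<close>

lemma is_t_idealI:
  assumes P: "is_ideal P" "P \<noteq> {0}"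
    and closed: "\<And>F. finite F \<Longrightarrow> F \<subseteq> P \<Longrightarrow>
          v_closure (fract_mod.span (to_fract ` F)) \<subseteq> to_fract ` P"
  shows "is_t_ideal (to_fract ` P)"
proof -
  have "0 \<in> P" using P by (simp add: is_ideal_def)
  then obtain p where p: "p \<in> P" "p \<noteq> 0" using P by blast
  have "t_closure (to_fract ` P) = to_fract ` P"
  proof
    show "t_closure (to_fract ` P) \<subseteq> to_fract ` P"
    proof
      fix x assume "x \<in> t_closure (to_fract ` P)"
      then obtain F where F: "finite F" "fract_mod.span F \<subseteq> to_fract ` P"
        "x \<in> v_closure (fract_mod.span F)"
        by (auto simp: t_closure_def is_fg_fractional_ideal_def)
      have "F \<subseteq> to_fract ` P" using F(2) fract_mod.span_superset by blast
      then obtain F' where "finite F'" "F' \<subseteq> P" "F = to_fract ` F'"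
        using F(1) finite_subset_image by metis
      thus "x \<in> to_fract ` P" using closed F(3) by blast
    qed
    show "to_fract ` P \<subseteq> t_closure (to_fract ` P)"
    proof (rule image_subsetI)
      fix z assume z: "z \<in> P"
      \<comment> \<open>The generator \<open>p\<close> keeps the ideal nonzero in the case \<open>z = 0\<close>.\<close>
      let ?I = "fract_mod.span (to_fract ` {z, p})"
      have I: "is_fg_fractional_ideal ?I" "?I \<subseteq> to_fract ` P"
        using fg_fractional_ideal_span[OF P(1), of "{z, p}"] z p by auto
      have "to_fract z \<in> ?I" "to_fract p \<in> ?I" by (auto intro!: fract_mod.span_base)
      moreover have "to_fract p \<noteq> 0" using p by simp
      ultimately have "?I \<noteq> {0}" "to_fract z \<in> v_closure ?I"
        using subset_v_closure[of ?I] by blast+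
      thus "to_fract z \<in> t_closure (to_fract ` P)" unfolding t_closure_def using I by blast
    qed
  qed
  moreover have "is_fractional_ideal (to_fract ` P)"
    by (intro fractional_ideal_integral subspace_to_fract_image P) auto
  moreover have "to_fract p \<in> to_fract ` P" "to_fract p \<noteq> 0" using p by auto
  hence "to_fract ` P \<noteq> {0}" by blast
  ultimately show ?thesis by (simp add: is_t_ideal_def)
qed

text \<open>
  The last hypothesis is what a greatest common divisor \<open>d\<close> of \<open>q\<close> and \<open>r\<close> satisfies if it stays one
  under scaling.  It says that \<open>d\<close> lies in the v-closure of the ideal generated by \<open>q\<close> and \<open>r\<close>: whenever a
  fraction \<open>u / v\<close> multiplies both \<open>q\<close> and \<open>r\<close> into \<open>D\<close>, it multiplies \<open>d\<close> into \<open>D\<close>.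
\<close>

lemma t_ideal_closed_gcd:
  assumes P: "is_ideal P" "is_t_ideal (to_fract ` P)" and "q \<in> P" "r \<in> P" "q \<noteq> 0"
    and d: "\<And>u v. v dvd u * q \<Longrightarrow> v dvd u * r \<Longrightarrow> v dvd u * d"
  shows "d \<in> P"
proof -
  let ?I = "fract_mod.span (to_fract ` {q, r})"
  have I: "is_fg_fractional_ideal ?I" "?I \<subseteq> to_fract ` P"
    using fg_fractional_ideal_span[OF P(1), of "{q, r}"] assms by auto
  have mem: "to_fract q \<in> ?I" "to_fract r \<in> ?I" by (auto intro!: fract_mod.span_base)
  have "to_fract d \<in> v_closure ?I"
    unfolding v_closure_def inverse_ideal_def
  proof (intro CollectI ballI)
    fix y assume "y \<in> {x. \<forall>a\<in>?I. x * a \<in> range to_fract}"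
    with mem obtain s t where st: "y * to_fract q = to_fract s" "y * to_fract r = to_fract t"
      by blast
    obtain u v where y: "y = to_fract u / to_fract v" "v \<noteq> 0" by (rule fract_cases)
    have "to_fract (u * q) = to_fract (v * s)" "to_fract (u * r) = to_fract (v * t)"
      using st y by (simp_all add: field_simps)
    hence "u * q = v * s" "u * r = v * t" by (simp_all only: to_fract_eq_iff)
    hence "v dvd u * d" using d[of v u] by simp
    then obtain w where "u * d = v * w" by (auto simp: dvd_def)
    hence "to_fract u * to_fract d = to_fract v * to_fract w" by (simp flip: to_fract_mult)
    hence "to_fract d * y = to_fract w" unfolding y(1) using y(2) by (simp add: field_simps)
    thus "to_fract d * y \<in> range to_fract" by blast
  qed
  moreover have "?I \<noteq> {0}" using mem \<open>q \<noteq> 0\<close> by force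
  ultimately have "to_fract d \<in> t_closure (to_fract ` P)"
    unfolding t_closure_def using I by blast
  hence "to_fract d \<in> to_fract ` P" using P(2) by (simp add: is_t_ideal_def)
  thus ?thesis by auto
qed

text \<open>
  For the power of a single element, this is the inclusion \<open>(I\<^sub>v)\<^sup>n \<subseteq> (I\<^sup>n)\<^sub>v\<close>: the
  factors from \<open>I\<close> are exchanged for \<open>x\<close> one at a time.
\<close>

lemma v_closure_power:
  assumes "x \<in> v_closure I"
    and "\<And>l. length l = n \<Longrightarrow> set l \<subseteq> I \<Longrightarrow> y * prod_list l \<in> range to_fract"
  shows "y * x ^ n \<in> range to_fract"
  using assms(2)
proof (induction n arbitrary: y)
  case 0
  from "0.prems"[of "[]"] show ?case by simp
next
  case (Suc n)
  have "(x * y) * prod_list l \<in> range to_fract" if l: "length l = n" "set l \<subseteq> I" for l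
  proof -
    have "y * prod_list l \<in> inverse_ideal I"
      using Suc.prems[of "_ # l"] l by (auto simp: inverse_ideal_def mult_ac)
    hence "x * (y * prod_list l) \<in> range to_fract"
      using assms(1) by (auto simp: v_closure_def inverse_ideal_def)
    thus ?thesis by (simp add: mult.assoc)
  qed
  from Suc.IH[OF this] show ?case by (simp add: mult_ac)
qed

lemma v_closure_integral:
  assumes "I \<subseteq> range to_fract" shows "v_closure I \<subseteq> range to_fract"
proof
  fix x assume "x \<in> v_closure I"
  moreover have "1 \<in> inverse_ideal I" using assms by (auto simp: inverse_ideal_def)
  ultimately have "x * 1 \<in> range to_fract"
    unfolding v_closure_def by (subst (asm) (1) inverse_ideal_def) blast
  thus "x \<in> range to_fract" by simp
qed

text \<open>
  A finitely generated nonzero ideal \<open>I \<subseteq> radical a\<close> lies in \<open>f V\<close> for one of its generators \<open>f\<close>.  If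
  \<open>a\<close> divides \<open>f\<^sup>n\<close>, contraction gives \<open>I\<^sup>n \<subseteq> a D\<close>, so \<open>x\<^sup>n \<in> a D\<close> for every \<open>x \<in> I\<^sub>v\<close>.
\<close>

lemma radical_valuation_element_t_prime:
  fixes a :: "'a::idom"
  assumes "valuation_element a"
  shows "is_prime_t_ideal (radical a)"
proof -
  from assms obtain V where V: "valuation_overring V" "contracted V a" and a: "a \<noteq> 0" "\<not> a dvd 1"
    by (auto simp: valuation_element_iff)
  have prime: "is_prime_ideal (radical a)"
    using V(1,2) a(2) by (rule radical_contracted_prime)
  hence ideal: "is_ideal (radical a)" by (simp add: is_prime_ideal_def)
  have "radical a \<noteq> {0}" using self_in_radical[of a] a by auto
  moreover have "is_t_ideal (to_fract ` radical a)"
  proof (rule is_t_idealI[OF ideal \<open>radical a \<noteq> {0}\<close>], rule subsetI)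
    fix F x assume F: "finite F" "F \<subseteq> radical a"
      and x: "x \<in> v_closure (fract_mod.span (to_fract ` F))"
    let ?I = "fract_mod.span (to_fract ` F)"
    \<comment> \<open>Without generators the ideal is zero, and any element of the radical serves as \<open>f\<close>.\<close>
    obtain f where f: "f \<in> radical a" "\<forall>g\<in>F. divides_in V f g"
    proof (cases "F = {}")
      case True
      thus ?thesis using that self_in_radical by blast
    next
      case False
      thus ?thesis using divides_in_all_of_finite[OF V(1) F(1)] F(2) that by blast
    qed
    then obtain n where n: "a dvd f ^ n" by (auto simp: radical_def)
    have "is_ideal {z. divides_in V f z}"
      unfolding is_ideal_def
      using divides_in_add[OF V(1)] divides_in_mult[OF V(1) dvd_imp_divides_in[OF V(1)], of 1 _ f]
        dvd_imp_divides_in[OF V(1), of f 0] by auto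
    hence I: "?I \<subseteq> to_fract ` {z. divides_in V f z}"
      using f F(1) by (intro fg_fractional_ideal_span) auto
    have "1 / to_fract a * prod_list l \<in> range to_fract"
      if l: "length l = n" "set l \<subseteq> ?I" for l
    proof -
      have "\<exists>z. prod_list l = to_fract z \<and> divides_in V (f ^ length l) z"
        using l(2)
      proof (induction l)
        case Nil
        show ?case by (auto intro!: exI[of _ 1] dvd_imp_divides_in[OF V(1)])
      next
        case (Cons y l)
        then obtain z where z: "prod_list l = to_fract z" "divides_in V (f ^ length l) z" by auto
        obtain w where w: "y = to_fract w" "divides_in V f w" using Cons.prems I by auto
        show ?case using divides_in_mult[OF V(1) w(2) z(2)] z(1) w(1)
          by (auto intro!: exI[of _ "w * z"])
      qed
      then obtain z where z: "prod_list l = to_fract z" "divides_in V (f ^ n) z"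
        using l(1) by blast
      have "divides_in V a z"
        using divides_in_trans[OF V(1) dvd_imp_divides_in[OF V(1) n] z(2)] .
      hence "a dvd z" using V(2) by (auto simp: contracted_def)
      then obtain c where "z = a * c" by (auto simp: dvd_def)
      thus ?thesis using z(1) a(1) by simp
    qed
    from v_closure_power[OF x this]
    have xn: "1 / to_fract a * x ^ n \<in> range to_fract" by blast
    obtain z where z: "x = to_fract z" using x I v_closure_integral[of ?I] by blast
    from xn z obtain c where "to_fract z ^ n / to_fract a = to_fract c" by auto
    hence "to_fract (z ^ n) = to_fract (a * c)" using a(1) by (simp add: field_simps)
    hence "z ^ n = a * c" by (simp only: to_fract_eq_iff)
    hence "z \<in> radical a" by (intro radicalI[of _ _ n]) simp
    thus "x \<in> to_fract ` radical a" by (simp add: z)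
  qed
  ultimately show ?thesis using prime by (simp add: is_prime_t_ideal_def)
qed

text \<open>
  Initial segments of chains are chains, so only chains of lengths one and two matter.
\<close>

lemma t_dim_eq_1_iff:
  "t_dim TYPE('a::idom) = 1 \<longleftrightarrow>
     (\<exists>P::'a set. is_prime_t_ideal P) \<and>
     (\<forall>P Q::'a set. is_prime_t_ideal P \<longrightarrow> is_prime_t_ideal Q \<longrightarrow> \<not> P \<subset> Q)"
proof -
  define chain where "chain n \<longleftrightarrow> (\<exists>P :: nat \<Rightarrow> 'a set.
     (\<forall>i\<in>{1..n}. is_prime_t_ideal (P i)) \<and> (\<forall>i\<in>{1..<n}. P i \<subset> P (Suc i)))" for n
  have dim: "t_dim TYPE('a) = Sup {enat n | n. chain n}" by (simp add: t_dim_def chain_def)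
  have chain_mono: "chain m" if "chain n" "m \<le> n" for m n
  proof -
    from that(1) obtain P :: "nat \<Rightarrow> 'a set" where
      "\<forall>i\<in>{1..n}. is_prime_t_ideal (P i)" "\<forall>i\<in>{1..<n}. P i \<subset> P (Suc i)"
      unfolding chain_def by blast
    thus ?thesis using that(2) unfolding chain_def by (intro exI[of _ P]) simp
  qed
  have chain_1: "chain 1 \<longleftrightarrow> (\<exists>P::'a set. is_prime_t_ideal P)"
    by (auto simp: chain_def)
  have chain_2: "chain 2 \<longleftrightarrow>
      (\<exists>P Q::'a set. is_prime_t_ideal P \<and> is_prime_t_ideal Q \<and> P \<subset> Q)" (is "?L \<longleftrightarrow> ?R")
  proof
    assume ?L
    then obtain P :: "nat \<Rightarrow> 'a set" where
      "\<forall>i\<in>{1..2}. is_prime_t_ideal (P i)" "\<forall>i\<in>{1..<2}. P i \<subset> P (Suc i)"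
      unfolding chain_def by blast
    hence "is_prime_t_ideal (P 1)" "is_prime_t_ideal (P 2)" "P 1 \<subset> P (Suc 1)" by auto
    thus ?R by (metis Suc_1)
  next
    assume ?R
    then obtain P Q :: "'a set" where "is_prime_t_ideal P" "is_prime_t_ideal Q" "P \<subset> Q" by blast
    thus ?L unfolding chain_def
      by (intro exI[of _ "\<lambda>i. if i = 1 then P else Q"]) auto
  qed
  have "t_dim TYPE('a) = 1 \<longleftrightarrow> chain 1 \<and> \<not> chain 2"
  proof
    assume L: "t_dim TYPE('a) = 1"
    have "\<not> chain 2"
    proof
      assume "chain 2"
      hence "enat 2 \<le> 1" unfolding L[symmetric] dim by (intro Sup_upper) auto
      thus False by (simp add: one_enat_def)
    qed
    moreover have "chain 1"
    proof (rule ccontr)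
      assume "\<not> chain 1"
      hence "n = 0" if "chain n" for n using chain_mono[OF that, of 1] by (cases n) auto
      hence "t_dim TYPE('a) \<le> 0" unfolding dim by (intro Sup_least) (auto simp: zero_enat_def)
      with L show False by simp
    qed
    ultimately show "chain 1 \<and> \<not> chain 2" by blast
  next
    assume R: "chain 1 \<and> \<not> chain 2"
    have "n \<le> 1" if "chain n" for n
    proof (rule ccontr)
      assume "\<not> n \<le> 1"
      thus False using chain_mono[OF that, of 2] R by simp
    qed
    hence "t_dim TYPE('a) \<le> 1" unfolding dim by (intro Sup_least) (auto simp: one_enat_def)
    moreover have "t_dim TYPE('a) \<ge> 1"
      unfolding dim using R by (intro Sup_upper) (auto simp: one_enat_def)
    ultimately show "t_dim TYPE('a) = 1" by simp
  qed
  thus ?thesis unfolding chain_1 chain_2 by blast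
qed


section \<open>Valuation elements in one radical class\<close>

lemma valuation_element_dvd:
  assumes "valuation_element a" "b dvd a" "\<not> b dvd 1" shows "valuation_element b"
  using assms contracted_dvd unfolding valuation_element_iff by (metis dvd_0_left)

lemma valuation_element_radical_prime:
  "valuation_element a \<Longrightarrow> is_prime_ideal (radical a)"
  using radical_valuation_element_t_prime[of a] by (simp add: is_prime_t_ideal_def)

lemma unit_dvd_cancel:
  fixes x :: "'a::comm_ring_1"
  assumes "x dvd 1" "z dvd x * u" shows "z dvd u"
proof -
  from assms(1) obtain e where "x * e = 1" by (metis dvdE)
  hence "(x * e) * u = u" by simp
  hence "x * u * e = u" by (simp only: mult_ac)
  thus ?thesis using assms(2) by (metis dvd_mult2)
qed

lemma radical_of_dvd: "b dvd a \<Longrightarrow> a \<in> radical b"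
  by (rule radicalI[where n = 1]) simp

text \<open>
  If \<open>a\<close> divides \<open>b\<^sup>n\<close>, then \<open>a\<close>, \<open>b\<close> and \<open>a b\<close> all divide \<open>b\<close> to the power \<open>n + 1\<close>, which is
  contracted from the same valuation overring as \<open>b\<close>.
\<close>

lemma valuation_element_class:
  fixes a b :: "'a::idom"
  assumes a: "valuation_element a" and b: "valuation_element b" and "b \<in> radical a"
  shows "a dvd b \<or> b dvd a" "valuation_element (a * b)"
proof -
  from assms(3) obtain n where n: "a dvd b ^ n" by (auto simp: radical_def)
  from b obtain V where V: "valuation_overring V" "contracted V b" and b0: "b \<noteq> 0"
    by (auto simp: valuation_element_iff)
  from a have a0: "a \<noteq> 0" "\<not> a dvd 1" by (auto simp: valuation_element_iff)
  have V': "contracted V (b ^ Suc n)" using contracted_power[OF V b0] .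
  have dvd: "a * b dvd b ^ Suc n" using n by (simp add: mult.commute mult_dvd_mono)
  hence "a dvd b ^ Suc n" "b dvd b ^ Suc n" by (rule dvd_mult_left, rule dvd_mult_right)
  thus "a dvd b \<or> b dvd a"
    using divisors_of_contracted_comparable[OF V(1) V'] b0 by simp
  have "contracted V (a * b)" using contracted_dvd[OF V(1) V' _ dvd] b0 by simp
  moreover have "\<not> a * b dvd 1" using a0(2) by (auto dest: dvd_mult_left)
  ultimately show "valuation_element (a * b)"
    using V(1) a0 b0 by (auto simp: valuation_element_iff)
qed

text \<open>
  For nonzero \<open>x\<close> and \<open>z\<close>, the element \<open>g\<close> is a greatest common divisor, and the condition on the
  cofactors says \<open>x' D \<inter> z' D = x' z' D\<close>.  This implies that only units divide both cofactors and,
  unlike the latter property, passes to products in an arbitrary domain.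
\<close>

definition gcd_splitting :: "'a::idom \<Rightarrow> 'a \<Rightarrow> bool" where
  "gcd_splitting x z \<longleftrightarrow>
     (\<exists>g x' z'. x = g * x' \<and> z = g * z' \<and> (\<forall>u. z' dvd x' * u \<longrightarrow> z' dvd u))"

lemma gcd_splittingI:
  assumes "x = g * x'" "z = g * z'" "\<And>u. z' dvd x' * u \<Longrightarrow> z' dvd u"
  shows "gcd_splitting x z"
  unfolding gcd_splitting_def using assms by blast

lemma gcd_splittingE:
  assumes "gcd_splitting x z"
  obtains g x' z' where "x = g * x'" "z = g * z'" "\<And>u. z' dvd x' * u \<Longrightarrow> z' dvd u"
  using assms unfolding gcd_splitting_def by blast


section \<open>VFDs of t-dimension one\<close>

context
  assumes VFD: "VFD TYPE('a::idom)"
    and dim: "t_dim TYPE('a) = 1"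
begin

text \<open>Both radicals are prime t-ideals, and in t-dimension one these are pairwise incomparable.\<close>

lemma radical_eqI:
  fixes a b :: 'a
  assumes "valuation_element a" "valuation_element b" "b \<in> radical a"
  shows "radical b = radical a"
  using radical_subset[OF assms(3)] dim assms(1,2)[THEN radical_valuation_element_t_prime]
  unfolding t_dim_eq_1_iff by blast

text \<open>
  Collect the factors of \<open>z\<close> that lie in \<open>radical a\<close>.  They all have the radical of \<open>a\<close>, so their
  product, if not empty, is again a valuation element with this radical.
\<close>

lemma split_off_class:
  fixes a z :: 'a
  assumes a: "valuation_element a" and "z \<noteq> 0"
  obtains z0 z' where "z = z0 * z'" "z' \<notin> radical a"
    "z0 = 1 \<or> valuation_element z0 \<and> radical z0 = radical a"
proof -
  have prime: "is_prime_ideal (radical a)" using a by (rule valuation_element_radical_prime)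
  have unit: "u \<notin> radical a" if "u dvd 1" for u
    using radical_nonunit[of a u] a that by (auto simp: valuation_element_iff)
  have list: "\<exists>z0 z'. prod_list xs = z0 * z' \<and> z' \<notin> radical a \<and>
      (z0 = 1 \<or> valuation_element z0 \<and> radical z0 = radical a)"
    if "\<forall>x\<in>set xs. valuation_element x" for xs
    using that
  proof (induction xs)
    case Nil
    show ?case using unit[of 1] by (intro exI[of _ 1]) auto
  next
    case (Cons x xs)
    then obtain z0 z' where IH: "prod_list xs = z0 * z'" "z' \<notin> radical a"
      "z0 = 1 \<or> valuation_element z0 \<and> radical z0 = radical a" by auto
    have x: "valuation_element x" using Cons.prems by simp
    show ?case
    proof (cases "x \<in> radical a")
      case False
      hence "x * z' \<notin> radical a" using prime IH(2) by (auto simp: is_prime_ideal_def)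
      moreover have "prod_list (x # xs) = z0 * (x * z')" by (simp add: IH(1) mult.left_commute)
      ultimately show ?thesis using IH(3) by blast
    next
      case True
      hence rad: "radical x = radical a" by (rule radical_eqI[OF a x])
      have "valuation_element (x * z0) \<and> radical (x * z0) = radical a"
      proof (cases "z0 = 1")
        case True
        thus ?thesis using x rad by simp
      next
        case False
        hence z0: "valuation_element z0" "radical z0 = radical a" using IH(3) by auto
        hence "z0 \<in> radical x" using rad self_in_radical by blast
        hence v: "valuation_element (x * z0)" using valuation_element_class(2) x z0(1) by blast
        have "x * z0 \<in> radical x" by (rule radical_of_dvd) simp
        thus ?thesis using radical_eqI[OF x v] v rad by simp
      qed
      moreover have "prod_list (x # xs) = (x * z0) * z'" by (simp add: IH(1) mult.assoc)
      ultimately show ?thesis using IH(2) by blast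
    qed
  qed
  show ?thesis
  proof (cases "z dvd 1")
    case True
    thus ?thesis using that[of 1 z] unit by auto
  next
    case False
    then obtain xs where "\<forall>x\<in>set xs. valuation_element x" "z = prod_list xs"
      using VFD \<open>z \<noteq> 0\<close> unfolding VFD_def by blast
    thus ?thesis using list[of xs] that by blast
  qed
qed

text \<open>
  Write \<open>a c = s x\<close> and collect on both sides the part in the class of \<open>a\<close>.  These
  parts are comparable.  If the one of \<open>x\<close> were a proper divisor, cancelling it would leave an
  element of \<open>radical a\<close> on the left and none on the right.
\<close>

lemma valuation_element_cancel:
  fixes a s x :: 'a
  assumes a: "valuation_element a" and dvd: "a dvd s * x" and s: "s \<notin> radical a"
  shows "a dvd x"
proof (cases "x = 0")
  case False
  have prime: "is_prime_ideal (radical a)" using a by (rule valuation_element_radical_prime)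
  have "0 \<in> radical a" by (rule radicalI[where n = 1]) simp
  with s have "s \<noteq> 0" by blast
  obtain c where c: "s * x = a * c" using dvd by (auto simp: dvd_def)
  with False \<open>s \<noteq> 0\<close> have "c \<noteq> 0" by auto
  obtain c0 c' where c': "c = c0 * c'" "c' \<notin> radical a"
    "c0 = 1 \<or> valuation_element c0 \<and> radical c0 = radical a"
    using split_off_class[OF a \<open>c \<noteq> 0\<close>] .
  obtain x0 x' where x': "x = x0 * x'" "x' \<notin> radical a"
    "x0 = 1 \<or> valuation_element x0 \<and> radical x0 = radical a"
    using split_off_class[OF a False] .
  have ac0: "valuation_element (a * c0) \<and> radical (a * c0) = radical a"
  proof (cases "c0 = 1")
    case False
    hence c0: "valuation_element c0" "c0 \<in> radical a" using c'(3) self_in_radical by auto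
    hence "valuation_element (a * c0)" using valuation_element_class(2) a by blast
    moreover have "a * c0 \<in> radical a" by (rule radical_of_dvd) simp
    ultimately show ?thesis using radical_eqI a by blast
  qed (use a in simp)
  have "a * c0 dvd x0 \<or> x0 dvd a * c0"
  proof (cases "x0 = 1")
    case False
    hence "valuation_element x0" "x0 \<in> radical (a * c0)" using x'(3) ac0 self_in_radical by auto
    thus ?thesis using valuation_element_class(1) ac0 by blast
  qed simp
  moreover have "a * c0 dvd x0" if x0_dvd: "x0 dvd a * c0"
  proof -
    from x0_dvd obtain d where d: "a * c0 = x0 * d" by (auto simp: dvd_def)
    have "x0 * (d * c') = (a * c0) * c'" by (simp add: d mult.assoc)
    also have "\<dots> = s * x" by (simp add: c c'(1) mult.assoc)
    also have "\<dots> = x0 * (s * x')" by (simp add: x'(1) mult.left_commute)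
    finally have "x0 * (d * c') = x0 * (s * x')" .
    moreover have "x0 \<noteq> 0" using False x'(1) by auto
    ultimately have "d * c' = s * x'" by simp
    moreover have "s * x' \<notin> radical a" using prime s x'(2) by (auto simp: is_prime_ideal_def)
    ultimately have "d \<notin> radical a" using radical_mult[of d a c'] by (auto simp: mult.commute)
    have "d dvd 1"
    proof (rule ccontr)
      assume "\<not> d dvd 1"
      hence dv: "valuation_element d"
        using ac0 d valuation_element_dvd[of "a * c0" d] by simp
      moreover have "a * c0 \<in> radical d" using d by (intro radical_of_dvd) simp
      ultimately have "radical (a * c0) = radical d" using radical_eqI ac0 by blast
      thus False using \<open>d \<notin> radical a\<close> ac0 self_in_radical by blast
    qed
    then obtain e where "d * e = 1" by (metis dvdE)
    hence "a * c0 * e = x0" by (simp add: d mult.assoc)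
    hence "a * c0 dvd x0" by (metis dvd_triv_left)
    thus ?thesis .
  qed
  ultimately have "a * c0 dvd x0" by blast
  thus ?thesis using x'(1) by (metis dvd_mult2 dvd_mult_left)
qed simp

lemma valuation_element_primary:
  fixes a :: 'a
  assumes "valuation_element a" shows "primary_element a"
proof -
  have a: "a \<noteq> 0" "\<not> a dvd 1" using assms by (auto simp: valuation_element_iff)
  have mem: "z \<in> principal_ideal a \<longleftrightarrow> a dvd z" for z
    by (auto simp: principal_ideal_def dvd_def)
  have "\<exists>n>0. a dvd z ^ n" if "z \<in> radical a" for z
  proof -
    from that obtain n where "a dvd z ^ n" by (auto simp: radical_def)
    thus ?thesis using a(2) by (cases n) auto
  qed
  moreover have "1 \<notin> principal_ideal a" using a mem by blast
  moreover have "a dvd x \<or> y \<in> radical a" if "x * y \<in> principal_ideal a" for x y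
    using valuation_element_cancel[OF assms, of y x] that by (auto simp: mem mult.commute)
  ultimately have "is_primary_ideal (principal_ideal a)"
    unfolding is_primary_ideal_def is_ideal_def
    by (intro conjI allI ballI impI) (auto simp: mem)
  thus ?thesis using a by (simp add: primary_element_def)
qed

text \<open>
  The part \<open>z\<^sub>0\<close> of \<open>z\<close> in the class of \<open>a\<close>, or equal to \<open>1\<close>, is comparable with \<open>a\<close>, and the
  smaller of the two can be taken as \<open>g\<close>.  If this is \<open>z\<^sub>0\<close>, the cofactor of \<open>a\<close> is a unit or again in the class of \<open>a\<close>, and the
  cofactor of \<open>z\<close> lies outside the radical of this class and can be cancelled.
\<close>

lemma valuation_element_gcd_splitting:
  fixes a z :: 'a
  assumes a: "valuation_element a" and "z \<noteq> 0"
  shows "gcd_splitting a z"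
proof -
  obtain z0 z' where z: "z = z0 * z'" "z' \<notin> radical a"
    "z0 = 1 \<or> valuation_element z0 \<and> radical z0 = radical a"
    using split_off_class[OF assms] .
  have "a dvd z0 \<or> z0 dvd a"
  proof (cases "z0 = 1")
    case False
    hence "valuation_element z0" "z0 \<in> radical a" using z(3) self_in_radical by auto
    thus ?thesis using valuation_element_class(1) a by blast
  qed simp
  thus ?thesis
  proof
    assume "a dvd z0"
    then obtain w where "z = a * w" using z(1) by (metis dvdE mult.assoc)
    thus ?thesis using gcd_splittingI[of a a 1 z w] by simp
  next
    assume "z0 dvd a"
    then obtain a' where a': "a = z0 * a'" by (auto simp: dvd_def)
    have "a' \<noteq> 0" using a a' by (auto simp: valuation_element_iff)
    have "z' dvd u" if u: "z' dvd a' * u" for u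
    proof (cases "a' dvd 1")
      case True
      thus ?thesis using u by (rule unit_dvd_cancel)
    next
      case False
      hence va': "valuation_element a'" by (intro valuation_element_dvd[OF a]) (simp add: a')
      have "a \<in> radical a'" using a' by (intro radical_of_dvd) simp
      hence "radical a' = radical a" using radical_eqI[OF va' a] by simp
      moreover obtain c where c: "a' * u = z' * c" using u by (auto simp: dvd_def)
      ultimately have "a' dvd c"
        using valuation_element_cancel[OF va', of z' c] z(2) by (metis dvd_triv_left)
      then obtain c' where "c = a' * c'" by (auto simp: dvd_def)
      with c have "a' * u = a' * (z' * c')" by (simp add: mult_ac)
      thus ?thesis using \<open>a' \<noteq> 0\<close> by simp
    qed
    thus ?thesis by (rule gcd_splittingI[OF a' z(1)])
  qed
qed

text \<open>
  Split off greatest common divisors with the valuation factors of \<open>x\<close> one after the other, each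
  time continuing with the cofactor left over from \<open>z\<close>.
\<close>

lemma VFD_t_dim_1_gcd_splitting:
  fixes x z :: 'a
  assumes "x \<noteq> 0" "z \<noteq> 0"
  shows "gcd_splitting x z"
proof (cases "x dvd 1")
  case True
  show ?thesis by (rule gcd_splittingI[of x 1 x z z]) (simp, simp, rule unit_dvd_cancel[OF True])
next
  case False
  then obtain xs where xs: "\<forall>a\<in>set xs. valuation_element a" "x = prod_list xs"
    using VFD \<open>x \<noteq> 0\<close> unfolding VFD_def by blast
  have "gcd_splitting (prod_list xs) z"
    using xs(1) \<open>z \<noteq> 0\<close>
  proof (induction xs arbitrary: z)
    case Nil
    show ?case by (rule gcd_splittingI[of _ 1 1 z z]) simp_all
  next
    case (Cons a xs)
    have a: "valuation_element a" using Cons.prems by simp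
    obtain g a' z' where 1: "a = g * a'" "z = g * z'" "\<And>u. z' dvd a' * u \<Longrightarrow> z' dvd u"
      using valuation_element_gcd_splitting[OF a \<open>z \<noteq> 0\<close>] by (rule gcd_splittingE) blast
    have "z' \<noteq> 0" using 1(2) \<open>z \<noteq> 0\<close> by auto
    hence "gcd_splitting (prod_list xs) z'" using Cons.IH Cons.prems by simp
    then obtain h x' z'' where 2: "prod_list xs = h * x'" "z' = h * z''"
      "\<And>u. z'' dvd x' * u \<Longrightarrow> z'' dvd u"
      by (rule gcd_splittingE) blast
    have cancel: "z'' dvd u" if "z'' dvd (a' * x') * u" for u
    proof -
      have "h * z'' dvd h * ((a' * x') * u)" using that by (intro mult_dvd_mono) auto
      hence "z' dvd a' * (h * (x' * u))" by (simp add: 2(2) mult_ac)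
      hence "h * z'' dvd h * (x' * u)" unfolding 2(2)[symmetric] by (rule 1(3))
      moreover have "h \<noteq> 0" using 2(2) \<open>z' \<noteq> 0\<close> by auto
      ultimately have "z'' dvd x' * u" by simp
      thus ?thesis by (rule 2(3))
    qed
    have "prod_list (a # xs) = (g * h) * (a' * x')" "z = (g * h) * z''"
      by (simp_all add: 1(1,2) 2(1,2) mult_ac)
    thus ?case using cancel by (rule gcd_splittingI)
  qed
  thus ?thesis using xs(2) by simp
qed

text \<open>
  For a common divisor \<open>c\<close> with \<open>x = c f\<close> and \<open>z = c e\<close>, cross-multiplication gives \<open>x' e = z' f\<close>.  Hence
  \<open>z'\<close> divides \<open>e\<close>, and cancelling \<open>z'\<close> in \<open>z = g z' = c e\<close> shows that \<open>c\<close> divides \<open>g\<close>.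
\<close>

lemma VFD_t_dim_1_GCD_domain: "GCD_domain TYPE('a)"
  unfolding GCD_domain_def
proof (intro allI)
  fix x z :: 'a
  show "\<exists>d. d dvd x \<and> d dvd z \<and> (\<forall>c. c dvd x \<and> c dvd z \<longrightarrow> c dvd d)"
  proof (cases "x = 0 \<or> z = 0")
    case True
    thus ?thesis by (metis dvd_0_right dvd_refl)
  next
    case False
    then obtain g x' z' where s: "x = g * x'" "z = g * z'" "\<And>u. z' dvd x' * u \<Longrightarrow> z' dvd u"
      using VFD_t_dim_1_gcd_splitting[of x z] by (auto elim: gcd_splittingE)
    have "c dvd g" if "c dvd x" "c dvd z" for c
    proof -
      from that obtain f e where c: "x = c * f" "z = c * e" by (auto simp: dvd_def)
      have nz: "g \<noteq> 0" "c \<noteq> 0" "z' \<noteq> 0" using False s c by auto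
      have "c * g * (x' * e) = (g * x') * (c * e)" by (simp add: mult_ac)
      also have "\<dots> = (c * f) * (g * z')" by (simp only: s(1,2)[symmetric] c[symmetric])
      also have "\<dots> = c * g * (z' * f)" by (simp add: mult_ac)
      finally have "x' * e = z' * f" using nz by simp
      hence "z' dvd e" using s(3) by (metis dvd_triv_left)
      then obtain e' where e': "e = z' * e'" by (auto simp: dvd_def)
      have "z' * g = z" unfolding s(2) by (rule mult.commute)
      also have "\<dots> = z' * (c * e')" unfolding c(2) e' by (rule mult.left_commute)
      finally have "z' * g = z' * (c * e')" .
      thus ?thesis using nz by simp
    qed
    thus ?thesis using s(1,2) by (intro exI[of _ g]) auto
  qed
qed

lemma VFD_t_dim_1_weakly_factorial: "weakly_factorial TYPE('a)"
  using VFD valuation_element_primary unfolding VFD_def weakly_factorial_def by blast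

end


section \<open>Weakly factorial GCD-domains\<close>

lemma primary_element_cancel:
  assumes "primary_element q" "q dvd x * y" "\<not> q dvd x" shows "y \<in> radical q"
proof -
  have mem: "z \<in> principal_ideal q \<longleftrightarrow> q dvd z" for z
    by (auto simp: principal_ideal_def dvd_def)
  show ?thesis
    using assms unfolding primary_element_def is_primary_ideal_def mem radical_def by blast
qed

lemma radical_primary_mult:
  assumes "primary_element q" "x * y \<in> radical q" shows "x \<in> radical q \<or> y \<in> radical q"
proof -
  from assms(2) obtain n where "q dvd x ^ n * y ^ n"
    by (auto simp: radical_def power_mult_distrib)
  hence "q dvd x ^ n \<or> y ^ n \<in> radical q" using primary_element_cancel[OF assms(1)] by blast
  thus ?thesis by (auto simp: radical_def simp flip: power_mult)
qed

context
  assumes GCD: "GCD_domain TYPE('a::idom)"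
begin

text \<open>
  A greatest common divisor of \<open>u x\<close> and \<open>u y\<close> is a multiple of \<open>u\<close>, and its cofactor is a common
  divisor of \<open>x\<close> and \<open>y\<close>.
\<close>

lemma GCD_domain_gcd_scaled:
  fixes x y d u :: 'a
  assumes d: "d dvd x" "d dvd y" "\<And>c. c dvd x \<Longrightarrow> c dvd y \<Longrightarrow> c dvd d"
    and "c dvd u * x" "c dvd u * y"
  shows "c dvd u * d"
proof (cases "u = 0")
  case False
  obtain e where e: "e dvd u * x" "e dvd u * y"
    "\<And>c. c dvd u * x \<Longrightarrow> c dvd u * y \<Longrightarrow> c dvd e"
    using GCD unfolding GCD_domain_def by metis
  have "u dvd e" using e(3) by simp
  then obtain w where w: "e = u * w" by (auto simp: dvd_def)
  have "w dvd d" using e(1,2) False by (intro d(3)) (auto simp: w)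
  hence "e dvd u * d" by (simp add: w)
  thus ?thesis using e(3) assms(4,5) dvd_trans by blast
qed simp

lemma GCD_domain_euclid:
  fixes a b c :: 'a
  assumes "\<And>e. e dvd a \<Longrightarrow> e dvd b \<Longrightarrow> e dvd 1" "a dvd b * c" shows "a dvd c"
  using GCD_domain_gcd_scaled[of 1 a b a c] assms by (simp add: mult.commute)

lemma GCD_domain_coprime_power:
  fixes a b :: 'a
  assumes "\<And>e. e dvd a \<Longrightarrow> e dvd b \<Longrightarrow> e dvd 1" "e dvd a" "e dvd b ^ n"
  shows "e dvd 1"
  using assms(3)
proof (induction n)
  case (Suc n)
  have "e dvd b ^ n"
    using GCD_domain_euclid[of e b "b ^ n"] assms(1,2) Suc.prems dvd_trans by auto
  thus ?case by (rule Suc.IH)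
qed simp

lemma GCD_domain_split:
  fixes x y :: 'a
  assumes "x \<noteq> 0"
  obtains d x' y' where "x = d * x'" "y = d * y'" "\<And>e. e dvd x' \<Longrightarrow> e dvd y' \<Longrightarrow> e dvd 1"
    "\<And>u c. c dvd u * x \<Longrightarrow> c dvd u * y \<Longrightarrow> c dvd u * d"
proof -
  obtain d where d: "d dvd x" "d dvd y" "\<And>c. c dvd x \<Longrightarrow> c dvd y \<Longrightarrow> c dvd d"
    using GCD unfolding GCD_domain_def by metis
  then obtain x' y' where xy: "x = d * x'" "y = d * y'" by (auto simp: dvd_def)
  have "e dvd 1" if "e dvd x'" "e dvd y'" for e
  proof -
    have "d * e dvd d * 1" using d(3)[of "d * e"] that xy by (simp add: mult_dvd_mono)
    moreover have "d \<noteq> 0" using xy assms by auto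
    ultimately show ?thesis using dvd_mult_cancel_left by blast
  qed
  thus ?thesis using that xy GCD_domain_gcd_scaled[OF d] by blast
qed

text \<open>Otherwise \<open>q\<close> would divide powers of both elements, and these are coprime too.\<close>

lemma coprime_not_in_radical:
  fixes q x y :: 'a
  assumes "\<not> q dvd 1" "\<And>e. e dvd x \<Longrightarrow> e dvd y \<Longrightarrow> e dvd 1"
  shows "x \<notin> radical q \<or> y \<notin> radical q"
proof (rule ccontr)
  assume "\<not> ?thesis"
  then obtain m n where mn: "q dvd x ^ m" "q dvd y ^ n" by (auto simp: radical_def)
  have "e dvd 1" if "e dvd x ^ m" "e dvd y" for e
    using GCD_domain_coprime_power[of y x e m] assms(2) that by blast
  hence "q dvd 1" using GCD_domain_coprime_power[of "x ^ m" y q n] mn by blast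
  with assms(1) show False ..
qed

text \<open>
  One of the cofactors of a greatest common divisor \<open>d\<close> is outside \<open>radical q\<close>, so \<open>d\<close> must be inside.
\<close>

lemma radical_primary_gcd:
  fixes q x y :: 'a
  assumes q: "primary_element q" and xy: "x \<in> radical q" "y \<in> radical q"
  shows "\<exists>d\<in>radical q. d dvd x \<and> d dvd y"
proof (cases "x = 0")
  case False
  then obtain d x' y' where d: "x = d * x'" "y = d * y'"
    "\<And>e. e dvd x' \<Longrightarrow> e dvd y' \<Longrightarrow> e dvd 1" using GCD_domain_split by metis
  have "x' \<notin> radical q \<or> y' \<notin> radical q"
    using coprime_not_in_radical[OF _ d(3)] q by (auto simp: primary_element_def)
  hence "d \<in> radical q" using radical_primary_mult[OF q] xy d(1,2) by blast
  moreover have "d dvd x" "d dvd y" using d(1,2) by simp_all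
  ultimately show ?thesis by blast
next
  case True
  thus ?thesis using xy(2) by (intro bexI[of _ y]) auto
qed

lemma radical_primary_prime:
  fixes q :: 'a
  assumes q: "primary_element q" shows "is_prime_ideal (radical q)"
proof (rule is_prime_ideal_radicalI)
  fix z w assume "z \<in> radical q" "w \<in> radical q"
  then obtain d where d: "d \<in> radical q" "d dvd z" "d dvd w"
    using radical_primary_gcd[OF q] by blast
  then obtain c where "z + w = c * d" by (metis dvd_add dvdE mult.commute)
  thus "z + w \<in> radical q" using radical_mult d(1) by simp
qed (use q radical_primary_mult in \<open>auto simp: primary_element_def\<close>)

text \<open>
  A finite subset of \<open>radical q\<close> has a common divisor \<open>d\<close> there, so the v-closure of
  the ideal that it generates stays inside \<open>d D\<close>.
\<close>

lemma radical_primary_t_prime: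
  fixes q :: 'a
  assumes q: "primary_element q" shows "is_prime_t_ideal (radical q)"
proof -
  have prime: "is_prime_ideal (radical q)" using q by (rule radical_primary_prime)
  hence ideal: "is_ideal (radical q)" by (simp add: is_prime_ideal_def)
  have q0: "q \<noteq> 0" using q by (simp add: primary_element_def)
  hence nz: "radical q \<noteq> {0}" using self_in_radical[of q] by auto
  have "is_t_ideal (to_fract ` radical q)"
  proof (rule is_t_idealI[OF ideal nz], rule subsetI)
    fix F x assume F: "finite F" "F \<subseteq> radical q"
      and x: "x \<in> v_closure (fract_mod.span (to_fract ` F))"
    have "\<exists>d\<in>radical q. d \<noteq> 0 \<and> (\<forall>f\<in>F. d dvd f)" using F
    proof (induction rule: finite_induct)
      case empty
      show ?case using self_in_radical q0 by auto
    next
      case (insert f F)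
      then obtain d where d: "d \<in> radical q" "d \<noteq> 0" "\<forall>f\<in>F. d dvd f" by auto
      then obtain e where e: "e \<in> radical q" "e dvd d" "e dvd f"
        using radical_primary_gcd[OF q, of d f] insert.prems by auto
      hence "e \<noteq> 0" using d(2) by auto
      thus ?case using d e dvd_trans by blast
    qed
    then obtain d where d: "d \<in> radical q" "d \<noteq> 0" "\<forall>f\<in>F. d dvd f" by blast
    have "is_ideal {z. d dvd z}" by (auto simp: is_ideal_def)
    hence span: "fract_mod.span (to_fract ` F) \<subseteq> to_fract ` {z. d dvd z}"
      using d(3) F(1) by (intro fg_fractional_ideal_span) auto
    have "1 / to_fract d \<in> inverse_ideal (fract_mod.span (to_fract ` F))"
      unfolding inverse_ideal_def
    proof (intro CollectI ballI)
      fix y assume "y \<in> fract_mod.span (to_fract ` F)"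
      then obtain w where w: "y = to_fract w" "d dvd w" using span by auto
      then obtain z where "y = to_fract (d * z)" by (metis dvdE)
      thus "1 / to_fract d * y \<in> range to_fract" using d(2) by simp
    qed
    hence "x * (1 / to_fract d) \<in> range to_fract"
      using x unfolding v_closure_def inverse_ideal_def[of "inverse_ideal _"] by blast
    then obtain c where "x / to_fract d = to_fract c" by auto
    hence "x = to_fract (c * d)" using d(2) by (simp add: field_simps)
    thus "x \<in> to_fract ` radical q" using radical_mult[OF d(1)] by blast
  qed
  thus ?thesis using prime nz by (simp add: is_prime_t_ideal_def)
qed

text \<open>
  The localization of \<open>D\<close> at \<open>radical q\<close> is a valuation domain because a fraction in lowest
  terms has its numerator or its denominator outside \<open>radical q\<close>; primariness makes
  \<open>q D\<close> contracted from it.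
\<close>

lemma primary_element_valuation:
  fixes q :: 'a
  assumes q: "primary_element q" shows "valuation_element q"
proof -
  let ?P = "radical q"
  define V where "V = {to_fract x / to_fract s | x s. s \<notin> ?P}"
  have q0: "q \<noteq> 0" "\<not> q dvd 1" using q by (auto simp: primary_element_def)
  have VI: "to_fract x / to_fract s \<in> V" if "s \<notin> ?P" for x s
    using that by (auto simp: V_def)
  have nz: "s \<noteq> 0" if "s \<notin> ?P" for s using that radicalI[of q 0 1] by auto
  have mult: "s * t \<notin> ?P" if "s \<notin> ?P" "t \<notin> ?P" for s t
    using radical_primary_mult[OF q] that by blast
  have "1 \<notin> ?P" using q0 by (simp add: radical_def)
  have to_V: "to_fract r \<in> V" for r using VI[OF \<open>1 \<notin> ?P\<close>, of r] by simp
  have "is_subring V"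
    unfolding is_subring_def
  proof (intro conjI ballI)
    show "0 \<in> V" "1 \<in> V" using to_V[of 0] to_V[of 1] by auto
    fix x y assume "x \<in> V" "y \<in> V"
    then obtain a s b t where xy: "x = to_fract a / to_fract s" "s \<notin> ?P"
      "y = to_fract b / to_fract t" "t \<notin> ?P" by (auto simp: V_def)
    have "x - y = to_fract (a * t - b * s) / to_fract (s * t)"
      using nz[OF xy(2)] nz[OF xy(4)] unfolding xy(1,3) by (simp add: field_simps)
    thus "x - y \<in> V" using VI[OF mult] xy by metis
    have "x * y = to_fract (a * b) / to_fract (s * t)" using xy by simp
    thus "x * y \<in> V" using VI[OF mult] xy by metis
  qed
  moreover have "x \<in> V \<or> inverse x \<in> V" if "x \<noteq> 0" for x
  proof -
    obtain a b where ab: "x = to_fract a / to_fract b" "b \<noteq> 0" by (rule fract_cases)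
    with that have "a \<noteq> 0" by auto
    then obtain d a' b' where d: "a = d * a'" "b = d * b'"
      "\<And>e. e dvd a' \<Longrightarrow> e dvd b' \<Longrightarrow> e dvd 1" using GCD_domain_split by metis
    have "x = to_fract a' / to_fract b'" using ab d(1,2) by simp
    moreover from this have "inverse x = to_fract b' / to_fract a'" by simp
    ultimately have "b' \<notin> ?P \<Longrightarrow> x \<in> V" "a' \<notin> ?P \<Longrightarrow> inverse x \<in> V"
      using VI by auto
    thus ?thesis using coprime_not_in_radical[OF q0(2) d(3)] by blast
  qed
  ultimately have "valuation_overring V"
    using to_V by (auto simp: valuation_overring_def is_overring_def is_valuation_domain_def)
  moreover have "contracted V q"
    unfolding contracted_def
  proof (intro allI impI)
    fix z assume "divides_in V q z"
    then obtain x s where xs: "to_fract z = to_fract q * (to_fract x / to_fract s)" "s \<notin> ?P"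
      by (auto simp: divides_in_def V_def)
    hence "to_fract (z * s) = to_fract (q * x)" using nz by (simp add: field_simps)
    hence "z * s = q * x" by (simp only: to_fract_eq_iff)
    thus "q dvd z" using primary_element_cancel[OF q, of z s] xs(2) by auto
  qed
  ultimately show ?thesis using q0 by (auto simp: valuation_element_iff)
qed

text \<open>
  A greatest common divisor \<open>d\<close> of \<open>q\<close> and \<open>r\<close> lies in \<open>P\<close> as well and hence is not a unit.  This
  forces \<open>d\<close>, and with it the multiple \<open>r\<close>, into \<open>radical q\<close>.
\<close>

lemma primary_in_t_prime:
  fixes q r :: 'a
  assumes P: "is_prime_t_ideal P" and q: "primary_element q" "q \<in> P"
    and r: "primary_element r" "r \<in> P"
  shows "r \<in> radical q"
proof -
  have ideal: "is_ideal P" and t: "is_t_ideal (to_fract ` P)" and "P \<noteq> UNIV"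
    using P by (auto simp: is_prime_t_ideal_def is_prime_ideal_def)
  have "q \<noteq> 0" using q by (auto simp: primary_element_def)
  then obtain d q' r' where d: "q = d * q'" "r = d * r'"
    "\<And>u c. c dvd u * q \<Longrightarrow> c dvd u * r \<Longrightarrow> c dvd u * d" using GCD_domain_split by metis
  have "d \<in> P" using t_ideal_closed_gcd[OF ideal t q(2) r(2) \<open>q \<noteq> 0\<close> d(3)] .
  have "\<not> d dvd 1"
  proof
    assume "d dvd 1"
    hence "d dvd x" for x using dvd_trans one_dvd by blast
    hence "x \<in> P" for x using ideal \<open>d \<in> P\<close> unfolding is_ideal_def by (metis dvdE mult.commute)
    thus False using \<open>P \<noteq> UNIV\<close> by blast
  qed
  \<comment> \<open>Primariness of \<open>q = d q'\<close>, where \<open>q'\<close> is a proper divisor, puts \<open>d\<close> into the radical.\<close>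
  hence "\<not> q dvd q'" using \<open>q \<noteq> 0\<close> d(1) by (metis dvd_mult_cancel_right mult_1 mult_zero_right)
  hence "d \<in> radical q" using primary_element_cancel[OF q(1), of q' d] d(1) by (simp add: mult.commute)
  thus ?thesis using radical_mult[of d q r'] d(2) by (simp add: mult.commute)
qed

lemma dvd_prod_list: "x \<in> set xs \<Longrightarrow> (x::'b::comm_monoid_mult) dvd prod_list xs"
  by (induction xs) auto

context
  assumes WF: "weakly_factorial TYPE('a)"
begin

lemma primary_in_prime:
  fixes P :: "'a set"
  assumes P: "is_prime_ideal P" and x: "x \<in> P" "x \<noteq> 0"
  shows "\<exists>q\<in>P. primary_element q \<and> q dvd x"
proof -
  have "\<not> x dvd 1"
  proof
    assume "x dvd 1"
    hence "x dvd y" for y using dvd_trans one_dvd by blast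
    hence "y \<in> P" for y using P x unfolding is_prime_ideal_def is_ideal_def by (metis dvdE mult.commute)
    thus False using P by (auto simp: is_prime_ideal_def)
  qed
  then obtain xs where xs: "\<forall>q\<in>set xs. primary_element q" "x = prod_list xs"
    using WF x(2) unfolding weakly_factorial_def by blast
  thus ?thesis using prime_ideal_prod_list[OF P, of xs] x(1) dvd_prod_list by blast
qed

text \<open>
  If \<open>P \<subset> Q\<close>, then a primary element \<open>q \<in> P\<close> and a primary element \<open>r \<in> Q\<close> dividing an
  element outside \<open>P\<close> both lie in \<open>Q\<close>, so \<open>r \<in> radical q \<subseteq> P\<close>, a contradiction.
\<close>

lemma weakly_factorial_GCD_t_dim:
  assumes "\<exists>a::'a. a \<noteq> 0 \<and> \<not> a dvd 1"
  shows "t_dim TYPE('a) = 1"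
  unfolding t_dim_eq_1_iff
proof (intro conjI allI impI)
  from assms obtain a :: 'a and xs where "\<not> a dvd 1" "\<forall>q\<in>set xs. primary_element q" "a = prod_list xs"
    using WF unfolding weakly_factorial_def by blast
  then obtain q :: 'a where "primary_element q" by (cases xs) auto
  thus "\<exists>P::'a set. is_prime_t_ideal P" using radical_primary_t_prime by blast
next
  fix P Q :: "'a set"
  assume P: "is_prime_t_ideal P" and Q: "is_prime_t_ideal Q"
  have primes: "is_prime_ideal P" "is_prime_ideal Q" and "P \<noteq> {0}"
    using P Q by (auto simp: is_prime_t_ideal_def)
  have "0 \<in> P" using primes by (simp add: is_prime_ideal_def is_ideal_def)
  then obtain x where "x \<in> P" "x \<noteq> 0" using \<open>P \<noteq> {0}\<close> by blast
  then obtain q where q: "q \<in> P" "primary_element q" using primary_in_prime primes by blast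
  show "\<not> P \<subset> Q"
  proof
    assume sub: "P \<subset> Q"
    then obtain y where y: "y \<in> Q" "y \<notin> P" by blast
    hence "y \<noteq> 0" using \<open>0 \<in> P\<close> by auto
    then obtain r where r: "r \<in> Q" "primary_element r" "r dvd y"
      using primary_in_prime primes(2) y(1) by blast
    have "r \<in> radical q" using primary_in_t_prime[OF Q] q r sub by blast
    then obtain n where "q dvd r ^ n" by (auto simp: radical_def)
    hence "r ^ n \<in> P" using q(1) primes(1) unfolding is_prime_ideal_def is_ideal_def
      by (metis dvdE mult.commute)
    hence "prod_list (replicate n r) \<in> P" by simp
    from prime_ideal_prod_list[OF primes(1) this] have "r \<in> P" by auto
    hence "y \<in> P" using r(3) primes(1) unfolding is_prime_ideal_def is_ideal_def
      by (metis dvdE mult.commute)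
    with y(2) show False ..
  qed
qed

lemma weakly_factorial_GCD_VFD: "VFD TYPE('a)"
  using WF primary_element_valuation unfolding VFD_def weakly_factorial_def by blast

end

end


section \<open>The characterization\<close>

theorem corollary1p9:
  assumes not_field: "\<exists>a::'a::idom. a \<noteq> 0 \<and> \<not> a dvd 1"
  shows "VFD TYPE('a) \<and> t_dim TYPE('a) = 1 \<longleftrightarrow> weakly_factorial_GCD_domain TYPE('a)"
proof
  assume "VFD TYPE('a) \<and> t_dim TYPE('a) = 1"
  thus "weakly_factorial_GCD_domain TYPE('a)"
    by (simp add: weakly_factorial_GCD_domain_def VFD_t_dim_1_GCD_domain
        VFD_t_dim_1_weakly_factorial)
next
  assume "weakly_factorial_GCD_domain TYPE('a)"
  hence "GCD_domain TYPE('a)" "weakly_factorial TYPE('a)"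
    by (simp_all add: weakly_factorial_GCD_domain_def)
  thus "VFD TYPE('a) \<and> t_dim TYPE('a) = 1"
    using weakly_factorial_GCD_VFD weakly_factorial_GCD_t_dim not_field by blast
qed

end
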